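(* Let $G=G([n],E)$ be a simple graph, and let $T$ be a spanning tree of $G_{\mathbf{r}}$ rooted at $\mathbf{r}$. Then there exists a unique depiction function $p:[n]\sqcup\{\mathbf{r}\}\to\{0,1,\dots,n\}$ of $T$ such that: (i) for all edges $(i,k)$ and $(j,k)$ of $T$ with $i<j$, we have $p(i)>p(j)$; and (ii) every planar depiction $(D,p)$ of $T$ is non-crossing.
   Context: $G_{\mathbf{r}}$ is the graph with vertex set $[n]\sqcup\{\mathbf{r}\}$ obtained from $G$ by adding a new vertex $\mathbf{r}$ adjacent to every vertex of $G$. A spanning tree rooted at $\mathbf{r}$ is regarded as a directed graph with all edges oriented towards $\mathbf{r}$. For a finite acyclic digraph $T=T(V,E)$, a depiction function is a bijection $p:V\to\{0,1,\dots,|V|-1\}$ that is order-reversing: $(u,v)\in E$ implies $p(v)<p(u)$. A planar depiction $(D,p)$ of $T$ consists of such $p$ and the set $D\subseteq\mathbb{R}^2$ which is the image, under $(x,y)\mapsto(f(x),g(y))$ for some strictly increasing continuous $f,g:\mathbb{R}\to\mathbb{R}$ with $f(0)=g(0)=0$, of the union over $(u,v)\in E$ of the upper semicircles $\{(x,y):y=\sqrt{((p(u)-p(v))/2)^2-(x-(p(u)+p(v))/2)^2}\}$. It is non-crossing if every point $(x,y)\in D$ with $y>0$ has a small neighborhood in $D$ homeomorphic to the real line. *)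

theory Defs
  imports "HOL-Analysis.Analysis"
begin

text \<open>
  Undirected graphs are given by a vertex set and a set of two-element edges; directed graphs by
  a vertex set and a set of arcs.
\<close>

definition simple_graph :: "'a set \<Rightarrow> 'a set set \<Rightarrow> bool" where
  "simple_graph V E \<longleftrightarrow> finite V \<and> (\<forall>e\<in>E. e \<subseteq> V \<and> card e = 2)"

definition graph_path :: "'a set \<Rightarrow> 'a set set \<Rightarrow> 'a list \<Rightarrow> bool" where
  "graph_path V E xs \<longleftrightarrow>
     xs \<noteq> [] \<and> set xs \<subseteq> V \<and> distinct xs \<and> successively (\<lambda>u v. {u, v} \<in> E) xs"

definition graph_cycle :: "'a set \<Rightarrow> 'a set set \<Rightarrow> 'a list \<Rightarrow> bool" where
  "graph_cycle V E xs \<longleftrightarrow> graph_path V E xs \<and> length xs \<ge> 3 \<and> {last xs, hd xs} \<in> E"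

definition graph_connected :: "'a set \<Rightarrow> 'a set set \<Rightarrow> bool" where
  "graph_connected V E \<longleftrightarrow>
     V \<noteq> {} \<and> (\<forall>u\<in>V. \<forall>v\<in>V. \<exists>xs. graph_path V E xs \<and> hd xs = u \<and> last xs = v)"

definition graph_tree :: "'a set \<Rightarrow> 'a set set \<Rightarrow> bool" where
  "graph_tree V E \<longleftrightarrow>
     simple_graph V E \<and> graph_connected V E \<and> \<not> (\<exists>xs. graph_cycle V E xs)"

definition graph_spanning_tree :: "'a set \<Rightarrow> 'a set set \<Rightarrow> 'a set set \<Rightarrow> bool" where
  "graph_spanning_tree V E F \<longleftrightarrow> F \<subseteq> E \<and> graph_tree V F"

text \<open>
  Orientation of the tree \<open>(V, F)\<close> towards \<open>r\<close>: an edge \<open>{u, v}\<close> becomes the arc \<open>(u, v)\<close> if it is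
  the first edge of the path from \<open>u\<close> to \<open>r\<close>.
\<close>

definition orient_towards :: "'a set \<Rightarrow> 'a set set \<Rightarrow> 'a \<Rightarrow> ('a \<times> 'a) set" where
  "orient_towards V F r = {(u, v). \<exists>xs. graph_path V F (u # v # xs) \<and> last (v # xs) = r}"

definition rooted_spanning_tree :: "'a set \<Rightarrow> 'a set set \<Rightarrow> 'a \<Rightarrow> ('a \<times> 'a) set \<Rightarrow> bool" where
  "rooted_spanning_tree V E r T \<longleftrightarrow>
     r \<in> V \<and> (\<exists>F. graph_spanning_tree V E F \<and> T = orient_towards V F r)"

text \<open>
  The graph \<open>G\<^sub>r\<close>: the new vertex \<open>r\<close> is \<^term>\<open>None\<close>, and a vertex \<open>i\<close> of \<open>G\<close> is \<^term>\<open>Some i\<close>.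
\<close>

definition cone_verts :: "'a set \<Rightarrow> 'a option set" where
  "cone_verts V = insert None (Some ` V)"

definition cone_edges :: "'a set \<Rightarrow> 'a set set \<Rightarrow> 'a option set set" where
  "cone_edges V E = (\<lambda>e. Some ` e) ` E \<union> (\<lambda>v. {None, Some v}) ` V"

definition depiction_function :: "'a set \<Rightarrow> ('a \<times> 'a) set \<Rightarrow> ('a \<Rightarrow> nat) \<Rightarrow> bool" where
  "depiction_function V A p \<longleftrightarrow>
     bij_betw p V {0..<card V} \<and> (\<forall>(u, v)\<in>A. p v < p u)"

text \<open>
  The nonnegativity condition is needed because \<^const>\<open>sqrt\<close> is total, with \<open>sqrt (- x) = - sqrt x\<close>.
\<close>

definition upper_semicircle :: "real \<Rightarrow> real \<Rightarrow> (real \<times> real) set" where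
  "upper_semicircle a b =
     {(x, y). 0 \<le> ((a - b) / 2)\<^sup>2 - (x - (a + b) / 2)\<^sup>2 \<and>
              y = sqrt (((a - b) / 2)\<^sup>2 - (x - (a + b) / 2)\<^sup>2)}"

definition planar_depiction ::
  "'a set \<Rightarrow> ('a \<times> 'a) set \<Rightarrow> (real \<times> real) set \<Rightarrow> ('a \<Rightarrow> nat) \<Rightarrow> bool" where
  "planar_depiction V A D p \<longleftrightarrow>
     depiction_function V A p \<and>
     (\<exists>f g :: real \<Rightarrow> real.
        strict_mono f \<and> continuous_on UNIV f \<and> f 0 = 0 \<and>
        strict_mono g \<and> continuous_on UNIV g \<and> g 0 = 0 \<and>
        D = (\<lambda>(x, y). (f x, g y)) `
              (\<Union>(u, v)\<in>A. upper_semicircle (real (p u)) (real (p v))))"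

definition non_crossing :: "(real \<times> real) set \<Rightarrow> bool" where
  "non_crossing D \<longleftrightarrow>
     (\<forall>(x, y)\<in>D. y > 0 \<longrightarrow>
        (\<exists>U. openin (top_of_set D) U \<and> (x, y) \<in> U \<and> U homeomorphic (UNIV :: real set)))"

end

theory Submission
  imports Defs "HOL-Library.List_Lexorder"
begin

text \<open>
  Above the axis, two semicircles with different end points meet only if their end points interleave,
  and then in exactly one point, where the picture is not locally a line. Hence condition (ii) says
  that no two arcs have interleaving end points. An order-reversing labelling with this property gives
  each subtree a block of consecutive labels, so together with (i) it is the depth-first preorder in
  which the children of a vertex are visited by decreasing label. Giving each vertex the sequence of
  negated labels along its path from the root turns this preorder into the lexicographic order on
  sequences, and \<open>p\<close> into the rank in that order.
\<close>

section \<open>Orienting a tree towards its root\<close>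

lemma graph_path_tl: "graph_path V F (u # v # xs) \<Longrightarrow> graph_path V F (v # xs)"
  by (auto simp: graph_path_def)

text \<open>Both paths end in \<open>r\<close>, so the first one meets the second after
  \<open>u\<close>. Following it up to the first meeting vertex \<open>w\<close> and returning to
  \<open>u\<close> along the second path closes a cycle.\<close>

lemma graph_cycle_if_two_paths:
  assumes px: "graph_path V F (u # v # xs)" and lx: "last (v # xs) = r"
    and py: "graph_path V F (u # v' # ys)" and ly: "last (v' # ys) = r"
    and ne: "v \<noteq> v'"
  shows "\<exists>zs. graph_cycle V F zs"
proof -
  have "r \<in> set (v # xs)" "r \<in> set (v' # ys)"
    using lx ly by (metis last_in_set list.distinct(1))+
  then have "\<exists>w\<in>set (v # xs). w \<in> set (v' # ys)" by blast
  then obtain as w bs where xs: "v # xs = as @ w # bs" and w: "w \<in> set (v' # ys)"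
    and as: "\<forall>a\<in>set as. a \<notin> set (v' # ys)"
    by (elim split_list_first_propE)
  obtain cs ds where ys: "v' # ys = cs @ w # ds"
    using w by (meson split_list)
  have gx: "graph_path V F (u # as @ w # bs)" and gy: "graph_path V F (u # cs @ w # ds)"
    using px py xs ys by auto
  have hda: "hd (as @ [w]) = v" using xs by (cases as) auto
  have hdc: "hd (cs @ [w]) = v'" using ys by (cases cs) auto
  have dis: "set as \<inter> set cs = {}" "w \<notin> set as" "w \<notin> set cs"
    using as ys gy w by (auto simp: graph_path_def)
  let ?z = "u # as @ w # rev cs"
  have sc: "successively (\<lambda>x y. {x, y} \<in> F) (w # rev cs)"
    using gy by (auto simp: graph_path_def successively_Cons successively_append_iff
        insert_commute hd_rev)
  have "successively (\<lambda>x y. {x, y} \<in> F) ?z"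
    using gx sc by (auto simp: graph_path_def successively_Cons successively_append_iff hd_append)
  then have "graph_path V F ?z"
    using gx gy dis by (auto simp: graph_path_def)
  \<comment> \<open>If both were empty, then \<open>v = w = v'\<close>; hence there is a third
    vertex.\<close>
  moreover have "as \<noteq> [] \<or> cs \<noteq> []" using hda hdc ne by auto
  then have "length ?z \<ge> 3" by (cases as; cases cs) auto
  moreover have "last ?z = v'"
    using hdc by (cases cs) auto
  moreover have "{v', u} \<in> F"
    using py by (simp add: graph_path_def insert_commute)
  ultimately show ?thesis unfolding graph_cycle_def by auto
qed

text \<open>Arcs lead from child to parent. Unique parents, a root without parent and reachability
  of the root together exclude directed cycles.\<close>

locale rooted_arcs =
  fixes V :: "'a set" and A :: "('a \<times> 'a) set" and r :: 'a
  assumes finite_V: "finite V"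
    and root_in: "r \<in> V"
    and arcs_subset: "A \<subseteq> V \<times> V"
    and root_no_parent: "(r, v) \<notin> A"
    and parent_unique: "(u, v) \<in> A \<Longrightarrow> (u, v') \<in> A \<Longrightarrow> v = v'"
    and reaches_root: "u \<in> V \<Longrightarrow> (u, r) \<in> A\<^sup>*"

lemma orient_towards_reaches:
  "graph_path V F (u # xs) \<Longrightarrow> last (u # xs) = r \<Longrightarrow> (u, r) \<in> (orient_towards V F r)\<^sup>*"
proof (induction xs arbitrary: u)
  case (Cons v xs)
  then have "(u, v) \<in> orient_towards V F r"
    unfolding orient_towards_def by (auto split: if_splits)
  moreover have "(v, r) \<in> (orient_towards V F r)\<^sup>*"
    using Cons.IH Cons.prems graph_path_tl by force
  ultimately show ?case by (rule converse_rtrancl_into_rtrancl)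
qed simp

text \<open>Acyclicity makes the parent unique; connectedness makes the root reachable.\<close>

lemma rooted_arcs_orient_towards:
  assumes tree: "graph_tree V F" and r: "r \<in> V"
  shows "rooted_arcs V (orient_towards V F r) r"
proof
  show "finite V" using tree by (simp add: graph_tree_def simple_graph_def)
  show "r \<in> V" by fact
  show "orient_towards V F r \<subseteq> V \<times> V"
    by (auto simp: orient_towards_def graph_path_def)
  show "(r, v) \<notin> orient_towards V F r" for v
  proof
    assume "(r, v) \<in> orient_towards V F r"
    then obtain xs where "distinct (r # v # xs)" "last (v # xs) = r"
      unfolding orient_towards_def graph_path_def by auto
    then show False by (metis distinct.simps(2) last_in_set list.distinct(1))
  qed
  show "v = v'" if "(u, v) \<in> orient_towards V F r" "(u, v') \<in> orient_towards V F r" for u v v'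
  proof (rule ccontr)
    assume "v \<noteq> v'"
    moreover from that obtain xs ys where
      "graph_path V F (u # v # xs)" "last (v # xs) = r"
      "graph_path V F (u # v' # ys)" "last (v' # ys) = r"
      unfolding orient_towards_def by auto
    ultimately have "\<exists>zs. graph_cycle V F zs"
      using graph_cycle_if_two_paths by metis
    then show False using tree by (simp add: graph_tree_def)
  qed
  show "(u, r) \<in> (orient_towards V F r)\<^sup>*" if "u \<in> V" for u
  proof -
    have "graph_connected V F" using tree by (simp add: graph_tree_def)
    then have "\<exists>xs. graph_path V F xs \<and> hd xs = u \<and> last xs = r"
      unfolding graph_connected_def using that r by simp
    then obtain xs where xs: "graph_path V F xs" "hd xs = u" "last xs = r" by blast
    then have "xs = u # tl xs" by (cases xs) (auto simp: graph_path_def)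
    then show ?thesis using orient_towards_reaches[of V F u "tl xs" r] xs by simp
  qed
qed

section \<open>The preorder labelling\<close>

text \<open>Under a depiction function the parent is the left end of its arc, so up to exchanging
  the two arcs this is the only way of interleaving.\<close>

definition arcs_cross :: "('a \<times> 'a) set \<Rightarrow> ('a \<Rightarrow> nat) \<Rightarrow> bool" where
  "arcs_cross A p \<longleftrightarrow>
     (\<exists>u v u' v'. (u, v) \<in> A \<and> (u', v') \<in> A \<and> p v < p v' \<and> p v' < p u \<and> p u < p u')"

text \<open>Condition (i) with an abstract order on the children. Negated labels as keys turn its
  decreasing order into an increasing one.\<close>

definition siblings_ordered :: "('a \<times> 'a) set \<Rightarrow> ('a \<Rightarrow> 'b::ord) \<Rightarrow> ('a \<Rightarrow> nat) \<Rightarrow> bool" where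
  "siblings_ordered A key p \<longleftrightarrow>
     (\<forall>u v w. (u, w) \<in> A \<and> (v, w) \<in> A \<and> key u < key v \<longrightarrow> p u < p v)"

text \<open>A numbering by an initial segment is determined by the order it induces; uniqueness thus
  becomes a question about that order.\<close>

lemma bij_betw_nat_eq_rank:
  fixes p :: "'a \<Rightarrow> nat"
  assumes p: "bij_betw p V {0..<N}" and x: "x \<in> V"
  shows "p x = card {y \<in> V. p y < p x}"
proof -
  have "p ` {y \<in> V. p y < p x} = {0..<p x}"
  proof (intro equalityI subsetI)
    fix m assume "m \<in> {0..<p x}"
    moreover have "p x < N" using bij_betwE[OF p] x by auto
    ultimately have "m \<in> p ` V" using p by (auto simp: bij_betw_def)
    then show "m \<in> p ` {y \<in> V. p y < p x}"
      using \<open>m \<in> {0..<p x}\<close> by auto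
  qed auto
  moreover have "inj_on p {y \<in> V. p y < p x}"
    using p by (auto simp: bij_betw_def inj_on_def)
  ultimately show ?thesis
    using card_image[of p "{y \<in> V. p y < p x}"] by simp
qed

lemma rank_strict_mono:
  fixes w :: "'a \<Rightarrow> 'b::linorder"
  assumes "finite V" "x \<in> V" "w x < w y"
  shows "card {z \<in> V. w z < w x} < card {z \<in> V. w z < w y}"
proof (rule psubset_card_mono)
  show "{z \<in> V. w z < w x} \<subset> {z \<in> V. w z < w y}"
    using assms by (auto intro: less_trans)
qed (use assms in simp)

text \<open>Distinct elements have distinct ranks, all below \<open>card V\<close>, so counting
  gives surjectivity.\<close>

lemma bij_betw_rank:
  fixes w :: "'a \<Rightarrow> 'b::linorder"
  assumes fin: "finite V" and inj: "inj_on w V"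
  shows "bij_betw (\<lambda>x. card {z \<in> V. w z < w x}) V {0..<card V}"
proof -
  let ?p = "\<lambda>x. card {z \<in> V. w z < w x}"
  have "inj_on ?p V"
  proof (rule inj_onI, rule ccontr)
    fix x y assume *: "x \<in> V" "y \<in> V" "?p x = ?p y" "x \<noteq> y"
    then have "w x \<noteq> w y" using inj by (auto dest: inj_onD)
    then have "w x < w y \<or> w y < w x" by (simp add: neq_iff)
    then show False
      using rank_strict_mono[OF fin, of x w y] rank_strict_mono[OF fin, of y w x] * by auto
  qed
  moreover have "?p ` V \<subseteq> {0..<card V}"
    using fin by (auto intro!: psubset_card_mono)
  ultimately show ?thesis
    unfolding bij_betw_def by (simp add: card_image card_subset_eq)
qed

context rooted_arcs
begin

section \<open>Addresses: sequences of keys along the path from the root\<close>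

lemma parent_exists: "u \<in> V \<Longrightarrow> u \<noteq> r \<Longrightarrow> \<exists>v\<in>V. (u, v) \<in> A"
  using reaches_root[of u] arcs_subset by (auto elim: converse_rtranclE)

text \<open>A relation, because existence of an address rests on reaching the root and its
  uniqueness on the parent being unique.\<close>

inductive addr :: "('a \<Rightarrow> 'b) \<Rightarrow> 'a \<Rightarrow> 'b list \<Rightarrow> bool" for key where
  root: "addr key r []"
| child: "(u, v) \<in> A \<Longrightarrow> addr key v w \<Longrightarrow> addr key u (w @ [key u])"

lemma addr_exists: "u \<in> V \<Longrightarrow> \<exists>w. addr key u w"
proof -
  assume "u \<in> V"
  then have "(u, r) \<in> A\<^sup>*" by (rule reaches_root)
  then show ?thesis
    by (induction rule: converse_rtrancl_induct) (blast intro: addr.intros)+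
qed

lemma addr_unique: "addr key u w \<Longrightarrow> addr key u w' \<Longrightarrow> w = w'"
proof (induction arbitrary: w' rule: addr.induct)
  case root
  then show ?case by (cases rule: addr.cases) (auto simp: root_no_parent)
next
  case (child u v w)
  note IH = child.IH
  from child.prems show ?case
  proof (cases rule: addr.cases)
    case root
    then show ?thesis using child.hyps root_no_parent by simp
  next
    case (child v' w'')
    then have "v' = v" using \<open>(u, v) \<in> A\<close> parent_unique by blast
    then show ?thesis using \<open>addr key v' w''\<close> \<open>w' = w'' @ [key u]\<close> IH by simp
  qed
qed

definition address :: "('a \<Rightarrow> 'b) \<Rightarrow> 'a \<Rightarrow> 'b list" where
  "address key u = (THE w. addr key u w)"

lemma address_eq: "addr key u w \<Longrightarrow> address key u = w"
  unfolding address_def using addr_unique by blast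

lemma address_root: "address key r = []"
  by (simp add: address_eq addr.root)

lemma address_child: "(u, v) \<in> A \<Longrightarrow> address key u = address key v @ [key u]"
proof -
  assume uv: "(u, v) \<in> A"
  then obtain w where w: "addr key v w" using addr_exists[of v key] arcs_subset by blast
  show ?thesis using address_eq[OF w] address_eq[OF addr.child[OF uv w]] by simp
qed

text \<open>Only the root has the empty address; any other address ends in the key of its
  vertex.\<close>

lemma inj_on_address:
  assumes key: "inj_on key (V - {r})"
  shows "inj_on (address key) V"
proof (rule inj_onI)
  fix x y assume *: "x \<in> V" "y \<in> V" "address key x = address key y"
  show "x = y"
  proof (cases "x = r \<or> y = r")
    case True
    then show ?thesis
      using * parent_exists[of x] parent_exists[of y]
      by (metis address_child address_root snoc_eq_iff_butlast)
  next
    case False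
    then have "key x = key y"
      using * parent_exists[of x] parent_exists[of y]
      by (metis address_child append1_eq_conv)
    then show ?thesis using False * key by (auto dest: inj_onD)
  qed
qed

text \<open>Dropping the last entry of an address means moving to the parent, hence the induction
  from the right end of \<open>s\<close>.\<close>

lemma address_prefix:
  "x \<in> V \<Longrightarrow> address key x = w @ s \<Longrightarrow> \<exists>z\<in>V. address key z = w \<and> (x, z) \<in> A\<^sup>*"
proof (induction s arbitrary: x rule: rev_induct)
  case Nil
  then show ?case by auto
next
  case (snoc a s)
  then have "x \<noteq> r" using address_root[of key] by auto
  then obtain v where v: "v \<in> V" "(x, v) \<in> A" using parent_exists snoc.prems by blast
  then have "address key v = w @ s" using address_child[of x v key] snoc.prems by simp
  then show ?case
    using snoc.IH v by (meson converse_rtrancl_into_rtrancl)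
qed

section \<open>Uniqueness: the conditions force the order of the addresses\<close>

lemma depiction_le_descendant:
  assumes "depiction_function V A p" and "(x, z) \<in> A\<^sup>*"
  shows "p z \<le> p x"
  using assms(2)
proof (induction rule: converse_rtrancl_induct)
  case (step u v)
  then show ?case using assms(1) unfolding depiction_function_def by fastforce
qed simp

text \<open>
  If a descendant \<open>x\<close> of \<open>a\<close> were the first one beyond \<open>b\<close>, the arc from \<open>x\<close> to its parent would
  cross the arc from \<open>b\<close> to the common parent of \<open>a\<close> and \<open>b\<close>.
\<close>

lemma subtree_before_sibling:
  assumes dep: "depiction_function V A p" and nc: "\<not> arcs_cross A p"
    and a: "(a, k) \<in> A" and b: "(b, k) \<in> A" and ab: "p a < p b" and x: "(x, a) \<in> A\<^sup>*"
  shows "p x < p b"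
  using x
proof (induction rule: converse_rtrancl_induct)
  case (step x d)
  have arc: "p v < p u" if "(u, v) \<in> A" for u v
    using dep that unfolding depiction_function_def by auto
  have ad: "p a \<le> p d" using depiction_le_descendant[OF dep step.hyps(2)] .
  have "\<not> p b < p x"
    using nc b step.hyps(1) step.IH arc[OF a] ad unfolding arcs_cross_def
    by (meson order.strict_trans2)
  \<comment> \<open>If \<open>x\<close> were \<open>b\<close>, its parent \<open>d\<close> would be
    \<open>k\<close>, although \<open>p k < p a \<le> p d\<close>.\<close>
  moreover have "p x \<noteq> p b"
  proof
    assume "p x = p b"
    moreover have "x \<in> V" "b \<in> V" using step.hyps(1) b arcs_subset by auto
    ultimately have "x = b" using dep unfolding depiction_function_def bij_betw_def
      by (auto dest: inj_onD)
    then have "d = k" using step.hyps(1) b parent_unique by blast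
    then show False using arc[OF a] ad by simp
  qed
  ultimately show ?case by simp
qed (fact ab)

text \<open>If the smaller address is a prefix, \<open>x\<close> is an ancestor of \<open>y\<close>.
  Otherwise the first difference yields sibling ancestors \<open>a\<close> of \<open>x\<close> and
  \<open>b\<close> of \<open>y\<close>; the sibling condition puts \<open>a\<close> before
  \<open>b\<close>, and then the whole subtree of \<open>a\<close> precedes
  \<open>b\<close>.\<close>

lemma depiction_mono_address:
  fixes key :: "'a \<Rightarrow> 'b::linorder"
  assumes key: "inj_on key (V - {r})"
    and dep: "depiction_function V A p" and nc: "\<not> arcs_cross A p"
    and sib: "siblings_ordered A key p"
    and x: "x \<in> V" and y: "y \<in> V" and less: "address key x < address key y"
  shows "p x < p y"
proof -
  note inj = inj_on_address[OF key]
  from less consider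
      (prefix) c s where "address key y = address key x @ c # s"
    | (branch) w c d s t where "c < d" "address key x = w @ c # s" "address key y = w @ d # t"
    unfolding list_less_def lexord_def by blast
  then show ?thesis
  proof cases
    case prefix
    then obtain z where "z \<in> V" "address key z = address key x" "(y, z) \<in> A\<^sup>*"
      using address_prefix[OF y] by blast
    then have "(y, x) \<in> A\<^sup>*" using inj x by (metis inj_onD)
    then have "p x \<le> p y" using depiction_le_descendant[OF dep] by blast
    moreover have "p x \<noteq> p y"
      using dep x y less unfolding depiction_function_def bij_betw_def
      by (metis inj_onD less_irrefl)
    ultimately show ?thesis by simp
  next
    case branch
    have ax: "address key x = (w @ [c]) @ s" and ay: "address key y = (w @ [d]) @ t"
      using branch by auto
    obtain a where a: "a \<in> V" "address key a = w @ [c]" "(x, a) \<in> A\<^sup>*"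
      using address_prefix[OF x ax] by blast
    obtain b where b: "b \<in> V" "address key b = w @ [d]" "(y, b) \<in> A\<^sup>*"
      using address_prefix[OF y ay] by blast
    have "a \<noteq> r" "b \<noteq> r" using a b address_root[of key] by auto
    then obtain k l where k: "k \<in> V" "(a, k) \<in> A" and l: "l \<in> V" "(b, l) \<in> A"
      using parent_exists a b by blast
    have "address key k = w" "key a = c" "address key l = w" "key b = d"
      using address_child[OF k(2), of key] address_child[OF l(2), of key] a b by auto
    then have "k = l" using inj k l by (metis inj_onD)
    have "p a < p b"
      using sib k l \<open>k = l\<close> \<open>key a = c\<close> \<open>key b = d\<close> \<open>c < d\<close> unfolding siblings_ordered_def by blast
    then have "p x < p b"
      using subtree_before_sibling[OF dep nc k(2)] l \<open>k = l\<close> a by blast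
    also have "p b \<le> p y" using depiction_le_descendant[OF dep b(3)] .
    finally show ?thesis .
  qed
qed

text \<open>For injective keys this is the position, counted from 0, in the depth-first preorder
  that visits children by increasing key.\<close>

definition preorder_rank :: "('a \<Rightarrow> 'b::linorder) \<Rightarrow> 'a \<Rightarrow> nat" where
  "preorder_rank key x = card {z \<in> V. address key z < address key x}"

text \<open>Addresses are distinct and linearly ordered, so the one-way monotonicity already makes
  \<open>p\<close> and \<open>address key\<close> induce the same order; both sides are ranks in
  it.\<close>

lemma depiction_eq_preorder_rank:
  fixes key :: "'a \<Rightarrow> 'b::linorder"
  assumes key: "inj_on key (V - {r})"
    and dep: "depiction_function V A p" and nc: "\<not> arcs_cross A p"
    and sib: "siblings_ordered A key p" and x: "x \<in> V"
  shows "p x = preorder_rank key x"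
proof -
  note mono = depiction_mono_address[OF key dep nc sib]
  have "p y < p x \<longleftrightarrow> address key y < address key x" if "y \<in> V" for y
    using mono[of x y] mono[of y x] that x inj_onD[OF inj_on_address[OF key], of x y]
    by (cases "address key x" "address key y" rule: linorder_cases) auto
  then have "{y \<in> V. p y < p x} = {y \<in> V. address key y < address key x}" by auto
  then show ?thesis
    using bij_betw_nat_eq_rank[of p V "card V" x] dep x
    unfolding depiction_function_def preorder_rank_def by simp
qed

section \<open>Existence: the preorder rank satisfies all conditions\<close>

lemma preorder_rank_less_iff:
  assumes key: "inj_on key (V - {r})" and "x \<in> V" "y \<in> V"
  shows "preorder_rank key x < preorder_rank key y \<longleftrightarrow> address key x < address key y"
  using rank_strict_mono[OF finite_V, of x "address key" y]
    rank_strict_mono[OF finite_V, of y "address key" x] assms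
    inj_onD[OF inj_on_address[OF key], of x y]
  unfolding preorder_rank_def
  by (cases "address key x" "address key y" rule: linorder_cases) auto

lemma preorder_rank_depiction:
  assumes key: "inj_on key (V - {r})"
  shows "depiction_function V A (preorder_rank key)"
proof -
  have "preorder_rank key v < preorder_rank key u" if "(u, v) \<in> A" for u v
  proof -
    have "address key v < address key u"
      using address_child[OF that, of key] by (simp add: list_less_def lexord_append_rightI)
    then show ?thesis using preorder_rank_less_iff[OF key] that arcs_subset by auto
  qed
  then show ?thesis
    using bij_betw_rank[OF finite_V inj_on_address[OF key]]
    unfolding depiction_function_def preorder_rank_def by auto
qed

lemma preorder_rank_siblings_ordered:
  assumes key: "inj_on key (V - {r})"
  shows "siblings_ordered A key (preorder_rank key)"
  unfolding siblings_ordered_def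
proof clarify
  fix u v w assume *: "(u, w) \<in> A" "(v, w) \<in> A" "key u < key v"
  then have "address key u < address key v"
    by (auto simp: address_child[of _ w key] list_less_def lexord_same_pref_iff)
  then show "preorder_rank key u < preorder_rank key v"
    using preorder_rank_less_iff[OF key] * arcs_subset by auto
qed

text \<open>A vertex \<open>v'\<close> strictly between \<open>v\<close> and its child
  \<open>u\<close> lies in the subtree of an earlier sibling of \<open>u\<close>, and so does every
  child \<open>u'\<close> of \<open>v'\<close>.\<close>

lemma preorder_rank_not_cross:
  assumes key: "inj_on key (V - {r})"
  shows "\<not> arcs_cross A (preorder_rank key)"
proof
  assume "arcs_cross A (preorder_rank key)"
  then obtain u v u' v' where arcs: "(u, v) \<in> A" "(u', v') \<in> A"
    and "preorder_rank key v < preorder_rank key v'" "preorder_rank key v' < preorder_rank key u"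
      "preorder_rank key u < preorder_rank key u'"
    unfolding arcs_cross_def by blast
  then have *: "address key v < address key v'" "address key v' < address key v @ [key u]"
      "address key v @ [key u] < address key v' @ [key u']"
    using preorder_rank_less_iff[OF key] arcs_subset address_child[of _ _ key]
    by (metis mem_Sigma_iff subsetD)+
  \<comment> \<open>The bounds force \<open>ys\<close> to extend \<open>xs\<close> with a next entry
    below \<open>c\<close>, and appending \<open>d\<close> does not change that entry.\<close>
  have "\<not> ys @ [d] > xs @ [c]" if "xs < ys" "ys < xs @ [c]" for xs ys and c d :: 'b
    using that
  proof (induction xs arbitrary: ys)
    case Nil
    then show ?case by (cases ys) auto
  next
    case (Cons x xs)
    then show ?case by (cases ys) auto
  qed
  then show False using * by blast
qed

end

section \<open>Semicircles\<close>

text \<open>The radicand is a difference of squares; its factors are the distances of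
  \<open>x\<close> to the two end points.\<close>

lemma mem_upper_semicircle_iff:
  assumes "b < a"
  shows "(x, y) \<in> upper_semicircle a b \<longleftrightarrow> x \<in> {b..a} \<and> y = sqrt ((a - x) * (x - b))"
proof -
  have eq: "((a - b) / 2)\<^sup>2 - (x - (a + b) / 2)\<^sup>2 = (a - x) * (x - b)"
    by (simp add: power2_eq_square field_simps)
  have "0 \<le> (a - x) * (x - b) \<longleftrightarrow> x \<in> {b..a}"
    using assms by (auto simp: zero_le_mult_iff)
  then show ?thesis unfolding upper_semicircle_def mem_Collect_eq prod.case eq by simp
qed

lemma upper_semicircle_eq_image:
  assumes "b < a"
  shows "upper_semicircle a b = (\<lambda>x. (x, sqrt ((a - x) * (x - b)))) ` {b..a}"
  using mem_upper_semicircle_iff[OF assms] by auto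

lemma closed_upper_semicircle:
  assumes "b < a"
  shows "closed (upper_semicircle a b)"
  unfolding upper_semicircle_eq_image[OF assms]
  by (intro compact_imp_closed compact_continuous_image continuous_intros) auto

lemma upper_semicircle_pos_iff:
  assumes "b < a"
  shows "(x, y) \<in> upper_semicircle a b \<and> 0 < y \<longleftrightarrow>
    x \<in> {b<..<a} \<and> y = sqrt ((a - x) * (x - b))"
  using assms unfolding mem_upper_semicircle_iff[OF assms]
  by (auto simp: zero_less_mult_iff order_less_le)

text \<open>The part above the axis is the graph of a continuous function on an open interval, with
  inverse \<open>fst\<close>.\<close>

lemma upper_semicircle_pos_homeomorphic:
  assumes "b < a"
  shows "(upper_semicircle a b \<inter> {z. 0 < snd z}) homeomorphic (UNIV :: real set)"
proof -
  let ?c = "\<lambda>x. (x, sqrt ((a - x) * (x - b)))"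
  have im: "?c ` {b<..<a} = upper_semicircle a b \<inter> {z. 0 < snd z}"
    using upper_semicircle_pos_iff[OF assms] by fastforce
  have "homeomorphism {b<..<a} (?c ` {b<..<a}) ?c fst"
    by (rule homeomorphismI) (auto intro!: continuous_intros)
  then have 1: "{b<..<a} homeomorphic (?c ` {b<..<a})"
    using homeomorphic_def by blast
  have "{b<..<a} homeomorphic ball (0::real) 1"
    unfolding greaterThanLessThan_eq_ball using assms by (intro homeomorphic_balls) auto
  then have "{b<..<a} homeomorphic (UNIV :: real set)"
    using homeomorphic_ball01_UNIV homeomorphic_trans by blast
  then show ?thesis
    using 1 im homeomorphic_sym homeomorphic_trans by metis
qed

text \<open>Over a common \<open>x\<close>, moving the left end right and the right end no further
  out strictly lowers the product of distances; with equal left ends, cancelling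
  \<open>x - b\<close> gives equal right ends.\<close>

lemma upper_semicircles_nested_disjoint:
  assumes "b < a" "b' < a'" "b \<le> b'" and nc: "\<not> (b < b' \<and> b' < a \<and> a < a')"
    and z: "(x, y) \<in> upper_semicircle a b" "(x, y) \<in> upper_semicircle a' b'" "0 < y"
  shows "a = a' \<and> b = b'"
proof -
  have x: "b < x" "x < a" "b' < x" "x < a'" and "y = sqrt ((a - x) * (x - b))"
      "y = sqrt ((a' - x) * (x - b'))"
    using upper_semicircle_pos_iff[OF assms(1), of x y] upper_semicircle_pos_iff[OF assms(2), of x y] z
    by auto
  then have eq: "(a - x) * (x - b) = (a' - x) * (x - b')" by simp
  show ?thesis
  proof (cases "b = b'")
    case True
    then show ?thesis using eq x by simp
  next
    case False
    \<comment> \<open>\<open>nc\<close> leaves nested or separated intervals; both contain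
      \<open>x\<close>, so they are nested.\<close>
    then have "a' \<le> a" "b < b'" using nc x assms(3) by auto
    then have "(a' - x) * (x - b') < (a - x) * (x - b)"
      using x by (intro mult_le_less_imp_less) auto
    then show ?thesis using eq by simp
  qed
qed

text \<open>The whole open semicircle serves as neighbourhood: the others form a finite union of
  closed sets that misses it.\<close>

lemma non_crossing_semicircles:
  assumes fin: "finite I" and pos: "\<And>a b. (a, b) \<in> I \<Longrightarrow> b < a"
    and nc: "\<And>a b a' b'. (a, b) \<in> I \<Longrightarrow> (a', b') \<in> I \<Longrightarrow> \<not> (b < b' \<and> b' < a \<and> a < a')"
  shows "non_crossing (\<Union>(a, b)\<in>I. upper_semicircle a b)" (is "non_crossing ?S")
  unfolding non_crossing_def
proof clarify
  fix x y :: real and a b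
  assume ab: "(a, b) \<in> I" and z: "(x, y) \<in> upper_semicircle a b" "0 < y"
  let ?U = "upper_semicircle a b \<inter> {z. 0 < snd z}"
  let ?W = "{z. 0 < snd z} - (\<Union>(a', b')\<in>I - {(a, b)}. upper_semicircle a' b')"
  have "closed (\<Union>(a', b')\<in>I - {(a, b)}. upper_semicircle a' b')"
    using fin pos by (auto intro!: closed_UN closed_upper_semicircle)
  moreover have "open {z :: real \<times> real. 0 < snd z}"
    by (intro open_Collect_less continuous_intros)
  ultimately have "open ?W" by blast
  moreover have "?U = ?S \<inter> ?W"
  proof -
    have "(a', b') = (a, b)"
      if "(a', b') \<in> I" "w \<in> upper_semicircle a b" "w \<in> upper_semicircle a' b'" "0 < snd w" for a' b' w
    proof (cases w)
      case (Pair s t)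
      then show ?thesis
        \<comment> \<open>Both orders of the two arcs are supplied, since either left end may be the
          smaller.\<close>
        using upper_semicircles_nested_disjoint[OF pos[OF ab] pos[OF that(1)], of s t]
          upper_semicircles_nested_disjoint[OF pos[OF that(1)] pos[OF ab], of s t]
          nc[OF ab that(1)] nc[OF that(1) ab] that by (cases "b \<le> b'") auto
    qed
    then show ?thesis using ab by blast
  qed
  ultimately have "openin (top_of_set ?S) ?U" by (auto simp: openin_open)
  then show "\<exists>U. openin (top_of_set ?S) U \<and> (x, y) \<in> U \<and> U homeomorphic (UNIV :: real set)"
    using z upper_semicircle_pos_homeomorphic[OF pos[OF ab]] by (intro exI[of _ ?U]) auto
qed

text \<open>As \<open>f\<close> and \<open>g\<close> may be bounded, the image of the plane may be a
  proper subset. Invariance of domain still makes the map open and a homeomorphism onto its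
  image.\<close>

lemma non_crossing_rescale:
  fixes f g :: "real \<Rightarrow> real"
  assumes f: "strict_mono f" "continuous_on UNIV f"
    and g: "strict_mono g" "continuous_on UNIV g" "g 0 = 0"
    and S: "non_crossing S"
  shows "non_crossing ((\<lambda>(x, y). (f x, g y)) ` S)"
  unfolding non_crossing_def
proof clarify
  let ?h = "\<lambda>(x, y). (f x, g y)"
  have cont: "continuous_on UNIV ?h"
    unfolding case_prod_beta
    by (intro continuous_intros continuous_on_compose2[OF f(2)] continuous_on_compose2[OF g(2)]) auto
  have inj: "inj ?h"
    using strict_mono_eq[OF f(1)] strict_mono_eq[OF g(1)] by (auto simp: inj_def)
  fix x y assume xy: "(x, y) \<in> S" "0 < g y"
  then have "0 < y" using strict_mono_less[OF g(1), of 0 y] g(3) by simp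
  then obtain U where U: "openin (top_of_set S) U" "(x, y) \<in> U" "U homeomorphic (UNIV :: real set)"
    using S xy unfolding non_crossing_def by blast
  then obtain W where W: "open W" "U = S \<inter> W" by (auto simp: openin_open)
  have "open (?h ` W)"
    using invariance_of_domain[of W ?h] W cont inj continuous_on_subset inj_on_subset by blast
  moreover have "?h ` U = ?h ` S \<inter> ?h ` W"
    using W inj by (simp add: image_Int)
  ultimately have "openin (top_of_set (?h ` S)) (?h ` U)" by (auto simp: openin_open)
  moreover obtain k where "homeomorphism UNIV (range ?h) ?h k"
    using invariance_of_domain_homeomorphism[of UNIV ?h] cont inj by auto
  then have "homeomorphism U (?h ` U) ?h k"
    by (rule homeomorphism_of_subsets) auto
  then have "U homeomorphic ?h ` U" unfolding homeomorphic_def by blast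
  then have "(?h ` U) homeomorphic (UNIV :: real set)"
    by (rule homeomorphic_trans[OF homeomorphic_sym[THEN iffD1] U(3)])
  moreover have "(f x, g y) \<in> ?h ` U" using U(2) by force
  ultimately show "\<exists>U. openin (top_of_set (?h ` S)) U \<and> (f x, g y) \<in> U \<and>
      U homeomorphic (UNIV :: real set)" by blast
qed

text \<open>
  A homeomorphism of a neighbourhood of a crossing point onto the line would map a piece of each
  semicircle onto an open set (an injective continuous real function is open), and these two open
  sets would meet in one point only.
\<close>

lemma crossing_semicircles_not_non_crossing:
  assumes S: "upper_semicircle a b \<subseteq> S" "upper_semicircle a' b' \<subseteq> S"
    and cross: "b < b'" "b' < a" "a < a'"
  shows "\<not> non_crossing S"
proof
  assume nc: "non_crossing S"
  define c where "c x = (x, sqrt ((a - x) * (x - b)))" for x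
  define c' where "c' x = (x, sqrt ((a' - x) * (x - b')))" for x
  have ba: "b < a" and ba': "b' < a'" using cross by auto
  \<comment> \<open>The two radicands differ by a linear function of \<open>x\<close>;
    \<open>x0\<close> is its zero, unique because interleaving makes the slope nonzero.\<close>
  define x0 where "x0 = (a' * b' - a * b) / ((a' + b') - (a + b))"
  have den: "(a' + b') - (a + b) > 0" using cross by simp
  have "(a - x) * (x - b) = (a' - x) * (x - b') \<longleftrightarrow> x * ((a' + b') - (a + b)) = a' * b' - a * b" for x
    by (auto simp: algebra_simps)
  also have "\<dots> x \<longleftrightarrow> x = x0" for x
    unfolding x0_def using den by (simp add: eq_divide_eq)
  finally have eq_iff: "(a - x) * (x - b) = (a' - x) * (x - b') \<longleftrightarrow> x = x0" for x .
  \<comment> \<open>After clearing the denominator, these products are exactly the inequalities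
    \<open>b' < x0\<close> and \<open>x0 < a\<close>.\<close>
  have "0 < (a - b') * (b' - b)" "0 < (a' - a) * (a - b')" using cross by simp_all
  then have "b' < x0" "x0 < a"
    unfolding x0_def using den by (simp_all add: less_divide_eq divide_less_eq algebra_simps)
  then have x0: "x0 \<in> {b'<..<a}" by simp
  \<comment> \<open>The total \<open>sqrt\<close> is injective on all reals, so negative radicands
    cause no further meetings.\<close>
  have meet: "c x = c' x' \<longleftrightarrow> x = x0 \<and> x' = x0" for x x'
    unfolding c_def c'_def using eq_iff[of x] by auto
  have c_in: "c x \<in> S" "c' x \<in> S" if "x \<in> {b'<..<a}" for x
    using S that cross mem_upper_semicircle_iff[OF ba, of x "snd (c x)"]
      mem_upper_semicircle_iff[OF ba', of x "snd (c' x)"]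
    unfolding c_def c'_def by auto
  have "0 < snd (c x0)" unfolding c_def using x0 cross by simp
  then obtain U where U: "openin (top_of_set S) U" "c x0 \<in> U" "U homeomorphic (UNIV :: real set)"
    using nc c_in(1)[OF x0] unfolding non_crossing_def c_def by fastforce
  obtain W where W: "open W" "U = S \<inter> W" using U(1) by (auto simp: openin_open)
  obtain h k where hk: "homeomorphism U (UNIV :: real set) h k"
    using U(3) homeomorphic_def by blast
  have cont: "continuous_on UNIV c" "continuous_on UNIV c'"
    unfolding c_def c'_def by (intro continuous_intros)+
  have "open (c -` W \<inter> c' -` W \<inter> {b'<..<a})"
    using cont W(1) by (intro open_Int open_vimage) auto
  moreover have "x0 \<in> c -` W \<inter> c' -` W \<inter> {b'<..<a}"
    using x0 U(2) W(2) meet[of x0 x0] by auto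
  ultimately obtain e where e: "e > 0" "ball x0 e \<subseteq> c -` W \<inter> c' -` W \<inter> {b'<..<a}"
    using open_contains_ball by blast
  define J where "J = ball x0 e"
  have J: "open J" "x0 \<in> J" "is_interval J" "c ` J \<subseteq> U" "c' ` J \<subseteq> U"
    using e c_in W(2) unfolding J_def by (auto simp: is_interval_ball_real)
  have inj_h: "inj_on h U" and cont_h: "continuous_on U h"
    using hk by (auto simp: homeomorphism_def intro: inj_on_inverseI)
  have open_image: "open ((h \<circ> d) ` J)"
    if "continuous_on UNIV d" "inj d" "d ` J \<subseteq> U" for d
  proof -
    have "continuous_on J (h \<circ> d)"
      using that cont_h by (meson continuous_on_compose continuous_on_subset subset_UNIV)
    moreover have "inj_on (h \<circ> d) J"
      using that inj_h by (meson comp_inj_on inj_on_subset subset_UNIV)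
    ultimately show ?thesis
      using injective_eq_1d_open_map_UNIV[of J "h \<circ> d"] J by blast
  qed
  have "open ((h \<circ> c) ` J \<inter> (h \<circ> c') ` J)"
    using cont J by (intro open_Int open_image) (auto simp: inj_def c_def c'_def)
  moreover have "(h \<circ> c) ` J \<inter> (h \<circ> c') ` J = {h (c x0)}"
  proof (intro equalityI subsetI)
    fix t assume "t \<in> (h \<circ> c) ` J \<inter> (h \<circ> c') ` J"
    then obtain x x' where x: "x \<in> J" "x' \<in> J" "t = h (c x)" "t = h (c' x')" by auto
    then have "c x = c' x'" using inj_h J by (metis image_subset_iff inj_onD)
    then show "t \<in> {h (c x0)}" using meet x by auto
  next
    fix t assume "t \<in> {h (c x0)}"
    then show "t \<in> (h \<circ> c) ` J \<inter> (h \<circ> c') ` J"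
      using J(2) meet[of x0 x0] by (auto intro!: image_eqI[of _ _ x0])
  qed
  ultimately show False using not_open_singleton by metis
qed

text \<open>The undistorted union of semicircles is itself a planar depiction, and every other one
  is a rescaling of it; so it alone decides.\<close>

lemma planar_depictions_non_crossing_iff:
  assumes "finite A" and dep: "depiction_function V A p"
  shows "(\<forall>D. planar_depiction V A D p \<longrightarrow> non_crossing D) \<longleftrightarrow> \<not> arcs_cross A p"
proof
  assume nc: "\<not> arcs_cross A p"
  have arc: "p v < p u" if "(u, v) \<in> A" for u v
    using dep that unfolding depiction_function_def by auto
  let ?I = "(\<lambda>(u, v). (real (p u), real (p v))) ` A"
  let ?S = "\<Union>(u, v)\<in>A. upper_semicircle (real (p u)) (real (p v))"
  have "non_crossing (\<Union>(a, b)\<in>?I. upper_semicircle a b)"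
  proof (rule non_crossing_semicircles)
    show "finite ?I" using \<open>finite A\<close> by simp
    show "b < a" if "(a, b) \<in> ?I" for a b
      using that arc by auto
    show "\<not> (b < b' \<and> b' < a \<and> a < a')" if I: "(a, b) \<in> ?I" "(a', b') \<in> ?I" for a b a' b'
    proof
      assume less: "b < b' \<and> b' < a \<and> a < a'"
      obtain u v where uv: "(u, v) \<in> A" "a = real (p u)" "b = real (p v)"
        using I(1) by auto
      obtain u' v' where uv': "(u', v') \<in> A" "a' = real (p u')" "b' = real (p v')"
        using I(2) by auto
      have "p v < p v'" "p v' < p u" "p u < p u'" using less uv uv' by simp_all
      then have "arcs_cross A p" unfolding arcs_cross_def using uv(1) uv'(1) by meson
      then show False using nc by contradiction
    qed
  qed
  moreover have "(\<Union>(a, b)\<in>?I. upper_semicircle a b) = ?S" by auto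
  ultimately have S: "non_crossing ?S" by simp
  show "\<forall>D. planar_depiction V A D p \<longrightarrow> non_crossing D"
  proof (intro allI impI)
    fix D assume "planar_depiction V A D p"
    then obtain f g :: "real \<Rightarrow> real" where "strict_mono f" "continuous_on UNIV f"
      "strict_mono g" "continuous_on UNIV g" "g 0 = 0" "D = (\<lambda>(x, y). (f x, g y)) ` ?S"
      unfolding planar_depiction_def by blast
    then show "non_crossing D" using non_crossing_rescale S by blast
  qed
next
  assume nc: "\<forall>D. planar_depiction V A D p \<longrightarrow> non_crossing D"
  let ?S = "\<Union>(u, v)\<in>A. upper_semicircle (real (p u)) (real (p v))"
  have "planar_depiction V A ?S p"
    unfolding planar_depiction_def using dep
    by (intro conjI exI[of _ "\<lambda>x. x"]) (auto simp: strict_mono_def)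
  then have "non_crossing ?S" using nc by blast
  moreover have "\<not> non_crossing ?S"
    if "(u, v) \<in> A" "(u', v') \<in> A" "p v < p v'" "p v' < p u" "p u < p u'" for u v u' v'
    using that by (intro crossing_semicircles_not_non_crossing
        [of "real (p u)" "real (p v)" _ "real (p u')" "real (p v')"]) auto
  ultimately show "\<not> arcs_cross A p"
    unfolding arcs_cross_def by blast
qed

section \<open>Existence and uniqueness for the rooted cone\<close>

theorem theorem4p7:
  fixes n :: nat
    and E :: "nat set set"
    and T :: "(nat option \<times> nat option) set"
  assumes "simple_graph {1..n} E"
    and "rooted_spanning_tree (cone_verts {1..n}) (cone_edges {1..n} E) None T"
  shows "\<exists>!p. p \<in> cone_verts {1..n} \<rightarrow>\<^sub>E {0..n} \<and>
           depiction_function (cone_verts {1..n}) T p \<and>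
           (\<forall>i j k. (Some i, k) \<in> T \<and> (Some j, k) \<in> T \<and> i < j \<longrightarrow> p (Some i) > p (Some j)) \<and>
           (\<forall>D. planar_depiction (cone_verts {1..n}) T D p \<longrightarrow> non_crossing D)"
proof -
  let ?V = "cone_verts {1..n}"
  obtain F where "None \<in> ?V" "graph_tree ?V F" and T: "T = orient_towards ?V F None"
    using assms(2) unfolding rooted_spanning_tree_def graph_spanning_tree_def by auto
  then interpret rooted_arcs ?V T None
    unfolding T by (intro rooted_arcs_orient_towards)
  \<comment> \<open>Larger labels must come first, hence the negation. The value at
    \<open>None\<close> is unspecified, hence injectivity away from the root.\<close>
  define key :: "nat option \<Rightarrow> int" where "key u = - int (the u)" for u
  have key: "inj_on key (?V - {None})"
    by (auto simp: inj_on_def key_def cone_verts_def)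
  have card: "card ?V = Suc n"
    unfolding cone_verts_def by (simp add: card_image)
  have finT: "finite T"
    using finite_subset[OF arcs_subset] finite_V by blast
  \<comment> \<open>The root is never a child, so every sibling has the form
    \<open>Some i\<close>.\<close>
  have sib_iff: "(\<forall>i j k. (Some i, k) \<in> T \<and> (Some j, k) \<in> T \<and> i < j \<longrightarrow> p (Some i) > p (Some j))
      \<longleftrightarrow> siblings_ordered T key p" for p
  proof
    assume sib: "\<forall>i j k. (Some i, k) \<in> T \<and> (Some j, k) \<in> T \<and> i < j \<longrightarrow> p (Some i) > p (Some j)"
    show "siblings_ordered T key p"
      unfolding siblings_ordered_def
    proof clarify
      fix u v w assume *: "(u, w) \<in> T" "(v, w) \<in> T" "key u < key v"
      then obtain i j where "u = Some i" "v = Some j"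
        using root_no_parent by (cases u; cases v) auto
      then show "p u < p v" using sib * by (auto simp: key_def)
    qed
  next
    assume sib: "siblings_ordered T key p"
    show "\<forall>i j k. (Some i, k) \<in> T \<and> (Some j, k) \<in> T \<and> i < j \<longrightarrow> p (Some i) > p (Some j)"
    proof clarify
      fix i j k assume "(Some i, k) \<in> T" "(Some j, k) \<in> T" "i < j"
      moreover from \<open>i < j\<close> have "key (Some j) < key (Some i)" by (simp add: key_def)
      ultimately show "p (Some j) < p (Some i)" using sib unfolding siblings_ordered_def by meson
    qed
  qed
  define P where "P p \<longleftrightarrow> depiction_function ?V T p \<and> siblings_ordered T key p \<and> \<not> arcs_cross T p" for p
  \<comment> \<open>\<open>P\<close> depends only on the values on \<open>?V\<close>, so it survives
    the restriction below.\<close>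
  have P_cong: "P q" if "P p" and eq: "\<And>x. x \<in> ?V \<Longrightarrow> q x = p x" for p q
  proof -
    have arc: "q u = p u" "q v = p v" if "(u, v) \<in> T" for u v
      using eq that arcs_subset by auto
    have "bij_betw q ?V B \<longleftrightarrow> bij_betw p ?V B" for B
      using eq by (rule bij_betw_cong)
    then have "depiction_function ?V T q"
      using \<open>P p\<close> arc unfolding P_def depiction_function_def by auto
    moreover have "siblings_ordered T key q"
      using \<open>P p\<close> arc unfolding P_def siblings_ordered_def by metis
    moreover have "\<not> arcs_cross T q"
      using \<open>P p\<close> arc unfolding P_def arcs_cross_def by metis
    ultimately show ?thesis unfolding P_def by blast
  qed
  have "\<exists>!p. p \<in> ?V \<rightarrow>\<^sub>E {0..n} \<and> P p"
  proof (intro ex1I conjI)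
    \<comment> \<open>Values outside \<open>?V\<close> are fixed to \<open>undefined\<close>, so
      that agreement on \<open>?V\<close> yields equality of functions.\<close>
    let ?p = "restrict (preorder_rank key) ?V"
    have "P (preorder_rank key)"
      unfolding P_def using preorder_rank_depiction[OF key] preorder_rank_siblings_ordered[OF key]
        preorder_rank_not_cross[OF key] by blast
    then show "P ?p" using P_cong[of "preorder_rank key" ?p] by simp
    then have "bij_betw ?p ?V {0..n}"
      unfolding P_def depiction_function_def card by (simp add: atLeastLessThanSuc_atLeastAtMost)
    then show "?p \<in> ?V \<rightarrow>\<^sub>E {0..n}"
      by (auto simp del: restrict_apply dest: bij_betwE)
    fix q assume q: "q \<in> ?V \<rightarrow>\<^sub>E {0..n} \<and> P q"
    then have "q x = preorder_rank key x" if "x \<in> ?V" for x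
      using depiction_eq_preorder_rank[OF key _ _ _ that] unfolding P_def by blast
    then show "q = ?p" using q by (auto simp: PiE_def extensional_def)
  qed
  moreover have "depiction_function ?V T p \<and> siblings_ordered T key p \<and>
      (\<forall>D. planar_depiction ?V T D p \<longrightarrow> non_crossing D) \<longleftrightarrow> P p" for p
    unfolding P_def using planar_depictions_non_crossing_iff[OF finT, of ?V p] by blast
  ultimately show ?thesis unfolding sib_iff by simp
qed

end
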